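(* Let $E_1=\mathbb{R}$, $E_2=\mathbb{R}$. There exist sequences $(X_n)$ and $(Y_n)$ of real random variables (defined on one probability space) satisfying AI-1 but not AI-2.
   Context: $P_\xi$ denotes the distribution of $\xi$; $\mathbb{R}$ carries its usual metric and Borel $\sigma$-algebra $\mathcal{B}(\mathbb{R})$, and $\mathbb{R}\times\mathbb{R}$ the sum (equivalently, maximum) metric. AI-1: for all bounded uniformly continuous functions $h:\mathbb{R}\times\mathbb{R}\to\mathbb{R}$, $\int h\,dP_{(X_n,Y_n)}-\int h\,d(P_{X_n}\times P_{Y_n})\to 0$ as $n\to+\infty$. AI-2: for all $A,B\in\mathcal{B}(\mathbb{R})$, $|P_{(X_n,Y_n)}(A\times B)-P_{X_n}(A)P_{Y_n}(B)|\to 0$ as $n\to+\infty$. *)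

theory Defs
  imports "HOL-Probability.Probability"
begin

(* The library's metric on real \<times> real is the Euclidean one. It is bi-Lipschitz equivalent
   to the sum and maximum metrics, so uniform continuity means the same for all three.
   Likewise borel \<Otimes>\<^sub>M borel is the Borel sigma-algebra of the plane (fact borel_prod). *)

definition AI_1 :: "'a measure \<Rightarrow> (nat \<Rightarrow> 'a \<Rightarrow> real) \<Rightarrow> (nat \<Rightarrow> 'a \<Rightarrow> real) \<Rightarrow> bool" where
  "AI_1 M X Y \<longleftrightarrow>
    (\<forall>h :: real \<times> real \<Rightarrow> real.
       bounded (range h) \<and> uniformly_continuous_on UNIV h \<longrightarrow>
       (\<lambda>n. (\<integral>z. h z \<partial>distr M (borel \<Otimes>\<^sub>M borel) (\<lambda>\<omega>. (X n \<omega>, Y n \<omega>)))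
          - (\<integral>z. h z \<partial>(distr M borel (X n) \<Otimes>\<^sub>M distr M borel (Y n)))) \<longlonglongrightarrow> 0)"

definition AI_2 :: "'a measure \<Rightarrow> (nat \<Rightarrow> 'a \<Rightarrow> real) \<Rightarrow> (nat \<Rightarrow> 'a \<Rightarrow> real) \<Rightarrow> bool" where
  "AI_2 M X Y \<longleftrightarrow>
    (\<forall>A \<in> sets (borel :: real measure). \<forall>B \<in> sets (borel :: real measure).
       (\<lambda>n. \<bar>measure (distr M (borel \<Otimes>\<^sub>M borel) (\<lambda>\<omega>. (X n \<omega>, Y n \<omega>))) (A \<times> B)
           - measure (distr M borel (X n)) A * measure (distr M borel (Y n)) B\<bar>) \<longlonglongrightarrow> 0)"

end

theory Submission
  imports Defs
begin

text \<open>
  Let \<open>\<xi>\<close> be a fair sign and put \<open>X\<^sub>n = Y\<^sub>n = \<xi> / (n + 1)\<close>. Both sequences converge pointwise to the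
  constant \<open>0\<close>, so the joint laws and the products of the marginals have the same weak limit, the
  point mass at \<open>(0, 0)\<close>, and AI-1 follows by dominated convergence
  (lemma \<open>AI_1_if_tendsto_const\<close>). The sets of AI-2, on the other hand, may have
  the limit point on their boundary: for \<open>A = B = (0, \<infinity>)\<close> the events \<open>X\<^sub>n \<in> A\<close> and \<open>Y\<^sub>n \<in> B\<close> are
  both the event \<open>\<xi> > 0\<close>, so the joint probability is \<open>1/2\<close> for every \<open>n\<close> while
  the product of the marginals is \<open>1/4\<close>.
\<close>

lemma (in prob_space) expectation_tendsto_const:
  fixes f :: "nat \<Rightarrow> 'a \<Rightarrow> 'b :: metric_space" and h :: "'b \<Rightarrow> real"
  assumes meas: "\<And>n. (\<lambda>x. h (f n x)) \<in> borel_measurable M"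
    and lim: "\<And>x. x \<in> space M \<Longrightarrow> (\<lambda>n. f n x) \<longlonglongrightarrow> c"
    and cont: "continuous_on UNIV h" and bdd: "bounded (range h)"
  shows "(\<lambda>n. expectation (\<lambda>x. h (f n x))) \<longlonglongrightarrow> h c"
proof -
  obtain K where K: "\<And>z. norm (h z) \<le> K"
    using bdd by (auto simp: bounded_iff)
  have "(\<lambda>n. expectation (\<lambda>x. h (f n x))) \<longlonglongrightarrow> expectation (\<lambda>x. h c)"
  proof (rule integral_dominated_convergence[where w = "\<lambda>x. K"])
    show "AE x in M. (\<lambda>n. h (f n x)) \<longlonglongrightarrow> h c"
      using lim cont by (intro AE_I2 isCont_tendsto_compose[of c h])
        (auto simp: continuous_on_eq_continuous_at)
  qed (use meas K in auto)
  then show ?thesis by (simp add: prob_space)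
qed

text \<open>
  The joint law of \<open>(X\<^sub>n, Y\<^sub>n)\<close> is an image of \<open>M\<close>, and the product of the marginals is an image of
  \<open>M \<Otimes>\<^sub>M M\<close>; on both spaces the map converges pointwise to \<open>(a, b)\<close>.
\<close>

lemma (in prob_space) AI_1_if_tendsto_const:
  fixes X Y :: "nat \<Rightarrow> 'a \<Rightarrow> real"
  assumes X [measurable]: "\<And>n. X n \<in> borel_measurable M"
    and Y [measurable]: "\<And>n. Y n \<in> borel_measurable M"
    and limX: "\<And>x. x \<in> space M \<Longrightarrow> (\<lambda>n. X n x) \<longlonglongrightarrow> a"
    and limY: "\<And>x. x \<in> space M \<Longrightarrow> (\<lambda>n. Y n x) \<longlonglongrightarrow> b"
  shows "AI_1 M X Y"
  unfolding AI_1_def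
proof (intro allI impI, elim conjE)
  fix h :: "real \<times> real \<Rightarrow> real"
  assume bdd: "bounded (range h)" and uc: "uniformly_continuous_on UNIV h"
  have cont: "continuous_on UNIV h"
    using uc by (rule uniformly_continuous_imp_continuous)
  have h [measurable]: "h \<in> borel_measurable (borel \<Otimes>\<^sub>M borel)"
    using borel_measurable_continuous_onI[OF cont] by (simp add: borel_prod)
  interpret P: pair_prob_space M M ..
  have joint: "(\<integral>z. h z \<partial>distr M (borel \<Otimes>\<^sub>M borel) (\<lambda>\<omega>. (X n \<omega>, Y n \<omega>)))
      = expectation (\<lambda>\<omega>. h (X n \<omega>, Y n \<omega>))" for n
    by (rule integral_distr) measurable
  have prod: "(\<integral>z. h z \<partial>(distr M borel (X n) \<Otimes>\<^sub>M distr M borel (Y n)))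
      = P.expectation (\<lambda>p. h (X n (fst p), Y n (snd p)))" for n
  proof -
    interpret DY: prob_space "distr M borel (Y n)"
      by (rule prob_space_distr) measurable
    have "distr M borel (X n) \<Otimes>\<^sub>M distr M borel (Y n)
        = distr (M \<Otimes>\<^sub>M M) (borel \<Otimes>\<^sub>M borel) (\<lambda>(x, y). (X n x, Y n y))"
      by (rule pair_measure_distr) (measurable, rule DY.sigma_finite_measure_axioms)
    then show ?thesis
      by (simp add: integral_distr case_prod_beta)
  qed
  have "(\<lambda>n. expectation (\<lambda>\<omega>. h (X n \<omega>, Y n \<omega>))) \<longlonglongrightarrow> h (a, b)"
    by (rule expectation_tendsto_const) (auto intro!: tendsto_Pair limX limY cont bdd)
  moreover have "(\<lambda>n. P.expectation (\<lambda>p. h (X n (fst p), Y n (snd p)))) \<longlonglongrightarrow> h (a, b)"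
    by (rule P.expectation_tendsto_const)
      (auto intro!: tendsto_Pair limX limY cont bdd simp: space_pair_measure)
  ultimately show "(\<lambda>n. (\<integral>z. h z \<partial>distr M (borel \<Otimes>\<^sub>M borel) (\<lambda>\<omega>. (X n \<omega>, Y n \<omega>)))
      - (\<integral>z. h z \<partial>(distr M borel (X n) \<Otimes>\<^sub>M distr M borel (Y n)))) \<longlonglongrightarrow> 0"
    unfolding joint prod by (auto dest: tendsto_diff)
qed

theorem proposition10:
  shows "\<exists>(M :: real measure) (X :: nat \<Rightarrow> real \<Rightarrow> real) (Y :: nat \<Rightarrow> real \<Rightarrow> real).
    prob_space M \<and>
    (\<forall>n. X n \<in> borel_measurable M) \<and> (\<forall>n. Y n \<in> borel_measurable M) \<and>
    AI_1 M X Y \<and> \<not> AI_2 M X Y"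
proof -
  define M :: "real measure" where "M = measure_pmf (pmf_of_set {-1, 1})"
  define X :: "nat \<Rightarrow> real \<Rightarrow> real" where "X = (\<lambda>n \<omega>. \<omega> / real (Suc n))"
  interpret prob_space M
    unfolding M_def by (rule prob_space_measure_pmf)
  have X [measurable]: "X n \<in> borel_measurable M" for n
    by (simp add: M_def)
  have "(\<lambda>n. X n \<omega>) \<longlonglongrightarrow> 0" for \<omega>
    unfolding X_def by (rule LIMSEQ_Suc[OF lim_const_over_n])
  then have AI1: "AI_1 M X X"
    using X by (intro AI_1_if_tendsto_const)
  let ?A = "{0<..} :: real set"
  have half: "prob {0<..} = 1 / 2"
    by (simp add: M_def measure_pmf_of_set)
  have marginal: "measure (distr M borel (X n)) ?A = 1 / 2" for n
  proof -
    have "X n -` ?A \<inter> space M = {0<..}"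
      by (auto simp: X_def M_def zero_less_divide_iff)
    then show ?thesis by (simp add: measure_distr half)
  qed
  have joint: "measure (distr M (borel \<Otimes>\<^sub>M borel) (\<lambda>\<omega>. (X n \<omega>, X n \<omega>))) (?A \<times> ?A) = 1 / 2" for n
  proof -
    have "(\<lambda>\<omega>. (X n \<omega>, X n \<omega>)) -` (?A \<times> ?A) \<inter> space M = {0<..}"
      by (auto simp: X_def M_def zero_less_divide_iff)
    then show ?thesis by (simp add: measure_distr half)
  qed
  have "\<not> AI_2 M X X"
  proof
    assume "AI_2 M X X"
    then have "(\<lambda>n. \<bar>measure (distr M (borel \<Otimes>\<^sub>M borel) (\<lambda>\<omega>. (X n \<omega>, X n \<omega>))) (?A \<times> ?A)
        - measure (distr M borel (X n)) ?A * measure (distr M borel (X n)) ?A\<bar>) \<longlonglongrightarrow> 0"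
      unfolding AI_2_def by (elim ballE) auto
    then show False
      unfolding joint marginal by (simp add: LIMSEQ_const_iff)
  qed
  with AI1 X prob_space_axioms show ?thesis by blast
qed

end
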